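(* Let $d\ge2$ be an integer, $p\in[1,\infty]$, and let $E=\{E_a\}_{a=1}^d$, $F=\{F_b\}_{b=1}^d$ be rank-1 projective measurements acting on $\mathbb{C}^d$. Let $$p_{\mathrm{ave}}:=\frac{1}{2d^2}\sum_{a,b=1}^d\|E_a+F_b\|_\infty\quad\text{and}\quad \bar c:=2p_{\mathrm{ave}}-1.$$ Then $$\Upsilon_p(E,F)\ \ge\ d^2h_p(\bar c)-\alpha(\bar c)\,d\,\sqrt{d-d^2\bar c^2},$$ where $$h_p(c):=2^{\frac1p}\,c\sqrt{1-c^2},\qquad \alpha(\bar c):=\max\Big\{\frac{h_p(\bar c)}{1-\bar c},\ \frac{h_p(\bar c)}{\bar c},\ |h_p'(\bar c)|\Big\},$$ and $h_p'$ is the derivative of $h_p$. In particular, if $p_{\mathrm{ave}}=\frac12+\frac1{2\sqrt d}$, then $\Upsilon_p(E,F)\ge 2^{\frac1p}d\sqrt{d-1}$.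
   Context: A rank-1 projective measurement on $\mathbb{C}^d$ is a family $E_a=|e_a\rangle\langle e_a|$, $a=1,\dots,d$, with $\{|e_a\rangle\}$ an orthonormal basis of $\mathbb{C}^d$. The Schatten $p$-norm $\|A\|_p$ is the $\ell_p$-norm of the vector of singular values of $A$ (the largest singular value for $p=\infty$). Define $\Upsilon_p(E,F):=\sum_{a,b}\|[E_a,F_b]\|_p$, where $[A,B]=AB-BA$. Convention: $2^{1/p}=1$ for $p=\infty$. The quantity $p_{\mathrm{ave}}$ is the optimal average success probability of the quantum random access code encoding two classical dits into one qudit with decoding measurements $E,F$. For rank-1 projective measurements $\bar c$ equals the average overlap $\frac1{d^2}\sum_{a,b}|\langle e_a|f_b\rangle|$, where $F_b=|f_b\rangle\langle f_b|$. *)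

theory Defs
  imports "HOL-Analysis.Derivative" "Jordan_Normal_Form.Schur_Decomposition"
    "Jordan_Normal_Form.VS_Connect"
begin

no_notation Finite_Cartesian_Product.vec_nth (infixl \<open>$\<close> 90)

definition orthonormal_basis :: "nat \<Rightarrow> (nat \<Rightarrow> complex vec) \<Rightarrow> bool" where
  "orthonormal_basis d e \<longleftrightarrow>
     vectorspace.basis class_ring (module_vec TYPE(complex) d) (e ` {1..d}) \<and>
     (\<forall>a\<in>{1..d}. \<forall>b\<in>{1..d}. e a \<bullet>c e b = (if a = b then 1 else 0))"

definition ket_bra :: "complex vec \<Rightarrow> complex mat" where
  "ket_bra v = mat (dim_vec v) (dim_vec v) (\<lambda>(i, j). v $ i * cnj (v $ j))"

definition rank1_projective_measurement :: "nat \<Rightarrow> (nat \<Rightarrow> complex mat) \<Rightarrow> bool" where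
  "rank1_projective_measurement d E \<longleftrightarrow>
     (\<exists>e. orthonormal_basis d e \<and> (\<forall>a\<in>{1..d}. E a = ket_bra (e a)))"

text \<open>Singular values are counted with multiplicity. The roots of the characteristic polynomial
  below are real and nonnegative, so taking real parts loses nothing.\<close>

definition singular_values :: "complex mat \<Rightarrow> real multiset" where
  "singular_values A =
     image_mset (\<lambda>z. sqrt (Re z)) (proots (char_poly (mat_adjoint A * A)))"

definition schatten_norm :: "ereal \<Rightarrow> complex mat \<Rightarrow> real" where
  "schatten_norm p A =
     (if p = \<infinity> then Max (set_mset (singular_values A))
      else (\<Sum>s\<in>#singular_values A. s powr real_of_ereal p) powr (1 / real_of_ereal p))"

definition commutator :: "complex mat \<Rightarrow> complex mat \<Rightarrow> complex mat" where
  "commutator A B = A * B - B * A"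

definition Upsilon :: "nat \<Rightarrow> ereal \<Rightarrow> (nat \<Rightarrow> complex mat) \<Rightarrow> (nat \<Rightarrow> complex mat) \<Rightarrow> real" where
  "Upsilon d p E F = (\<Sum>a=1..d. \<Sum>b=1..d. schatten_norm p (commutator (E a) (F b)))"

definition p_ave :: "nat \<Rightarrow> (nat \<Rightarrow> complex mat) \<Rightarrow> (nat \<Rightarrow> complex mat) \<Rightarrow> real" where
  "p_ave d E F = 1 / (2 * (real d)\<^sup>2) * (\<Sum>a=1..d. \<Sum>b=1..d. schatten_norm \<infinity> (E a + F b))"

definition c_bar :: "nat \<Rightarrow> (nat \<Rightarrow> complex mat) \<Rightarrow> (nat \<Rightarrow> complex mat) \<Rightarrow> real" where
  "c_bar d E F = 2 * p_ave d E F - 1"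

definition two_root :: "ereal \<Rightarrow> real" where
  "two_root p = (if p = \<infinity> then 1 else 2 powr (1 / real_of_ereal p))"

definition h :: "ereal \<Rightarrow> real \<Rightarrow> real" where
  "h p c = two_root p * c * sqrt (1 - c\<^sup>2)"

definition alpha :: "ereal \<Rightarrow> real \<Rightarrow> real" where
  "alpha p c = Max {h p c / (1 - c), h p c / c, \<bar>deriv (h p) c\<bar>}"

end

theory Submission
  imports Defs
begin

text \<open>
  Let \<open>c\<^sub>a\<^sub>b\<close> be the overlap of the \<open>a\<close>-th and \<open>b\<close>-th basis vectors. The nonzero singular values
  of the commutator are \<open>c\<^sub>a\<^sub>b sqrt (1 - c\<^sub>a\<^sub>b\<^sup>2)\<close>, twice, so its Schatten norm is \<open>h p c\<^sub>a\<^sub>b\<close>; the largest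
  singular value of the sum of the projections is \<open>1 + c\<^sub>a\<^sub>b\<close>, so \<open>c_bar\<close> is the mean overlap.
  By Parseval the squared overlaps sum to \<open>d\<close>. On \<open>[0,1]\<close> the function \<open>h p\<close> lies above its chords
  from \<open>c_bar\<close> to the endpoints, where it vanishes; this bounds \<open>h p c\<^sub>a\<^sub>b\<close> from below by
  \<open>h p c_bar\<close> minus \<open>alpha p c_bar\<close> times \<open>\<bar>c\<^sub>a\<^sub>b - c_bar\<bar>\<close>, and Cauchy--Schwarz bounds the sum of
  these deviations through the variance of the overlaps.
\<close>

section \<open>Parseval's identity for an orthonormal basis\<close>

lemma cscalar_prod_eq_sum:
  fixes e v :: "complex vec"
  assumes "e \<in> carrier_vec d"
  shows "v \<bullet>c e = (\<Sum>k<d. cnj (e $ k) * v $ k)"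
  using assms by (simp add: scalar_prod_def lessThan_atLeast0 mult.commute)

lemma cnj_cscalar_prod:
  fixes e f :: "complex vec"
  assumes "e \<in> carrier_vec d" "f \<in> carrier_vec d"
  shows "cnj (f \<bullet>c e) = e \<bullet>c f"
  by (simp add: cscalar_prod_eq_sum[OF assms(1)] cscalar_prod_eq_sum[OF assms(2)] mult.commute)

lemma orthonormal_basis_carrier:
  assumes "orthonormal_basis d f" "b \<in> {1..d}"
  shows "f b \<in> carrier_vec d"
proof -
  interpret vec_space "TYPE(complex)" d .
  show ?thesis using assms unfolding orthonormal_basis_def basis_def by auto
qed

text \<open>Orthonormality says that \<open>V\<close>, the adjoint of the matrix \<open>U\<close>
  with columns \<open>f b\<close>, is a left inverse of \<open>U\<close>. For square matrices it is
  then a right inverse, and the entries of \<open>U * V = 1\<close> are the completeness relation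
  that collapses the expanded square. The basis is indexed from 1 and matrices from 0, hence the
  \<open>Suc b\<close>.\<close>

lemma parseval:
  assumes f: "orthonormal_basis d f" and e: "e \<in> carrier_vec d"
  shows "(\<Sum>b=1..d. (cmod (f b \<bullet>c e))\<^sup>2) = Re (e \<bullet>c e)"
proof -
  note fc = orthonormal_basis_carrier[OF f]
  define U where "U = mat d d (\<lambda>(i, b). f (Suc b) $ i)"
  define V where "V = mat d d (\<lambda>(b, i). cnj (f (Suc b) $ i))"
  have UV: "U \<in> carrier_mat d d" "V \<in> carrier_mat d d"
    by (auto simp: U_def V_def)
  have "V * U = 1\<^sub>m d"
  proof (rule eq_matI)
    fix a b assume "a < dim_row (1\<^sub>m d :: complex mat)" "b < dim_col (1\<^sub>m d :: complex mat)"
    then have ab: "a < d" "b < d" by auto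
    then have "(V * U) $$ (a, b) = f (Suc b) \<bullet>c f (Suc a)"
      by (subst cscalar_prod_eq_sum[OF fc]) (simp_all add: U_def V_def scalar_prod_def lessThan_atLeast0)
    then show "(V * U) $$ (a, b) = 1\<^sub>m d $$ (a, b)"
      using f ab by (auto simp: orthonormal_basis_def)
  qed (auto simp: U_def V_def)
  then have "U * V = 1\<^sub>m d"
    by (rule mat_mult_left_right_inverse[OF UV(2,1)])
  have complete: "(\<Sum>b<d. f (Suc b) $ i * cnj (f (Suc b) $ j)) = (if i = j then 1 else 0)"
    if "i < d" "j < d" for i j
  proof -
    have "(U * V) $$ (i, j) = (\<Sum>b<d. f (Suc b) $ i * cnj (f (Suc b) $ j))"
      using that by (simp add: U_def V_def scalar_prod_def lessThan_atLeast0)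
    with \<open>U * V = 1\<^sub>m d\<close> that show ?thesis by simp
  qed
  have "complex_of_real (\<Sum>b=1..d. (cmod (f b \<bullet>c e))\<^sup>2)
      = (\<Sum>b<d. (f (Suc b) \<bullet>c e) * cnj (f (Suc b) \<bullet>c e))"
    by (simp add: sum.atLeast1_atMost_eq flip: complex_norm_square)
  also have "\<dots> = (\<Sum>b<d. \<Sum>i<d. \<Sum>j<d.
      (cnj (e $ i) * f (Suc b) $ i) * (e $ j * cnj (f (Suc b) $ j)))"
    by (simp add: cscalar_prod_eq_sum[OF e] sum_product)
  also have "\<dots> = (\<Sum>i<d. \<Sum>b<d. \<Sum>j<d.
      (cnj (e $ i) * f (Suc b) $ i) * (e $ j * cnj (f (Suc b) $ j)))"
    by (rule sum.swap)
  also have "\<dots> = (\<Sum>i<d. \<Sum>j<d. \<Sum>b<d.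
      (cnj (e $ i) * f (Suc b) $ i) * (e $ j * cnj (f (Suc b) $ j)))"
    by (intro sum.cong refl sum.swap)
  also have "\<dots> = (\<Sum>i<d. \<Sum>j<d. (cnj (e $ i) * e $ j) *
      (\<Sum>b<d. f (Suc b) $ i * cnj (f (Suc b) $ j)))"
    by (simp add: sum_distrib_left mult_ac)
  also have "\<dots> = (\<Sum>i<d. \<Sum>j<d. if i = j then cnj (e $ i) * e $ j else 0)"
    by (intro sum.cong refl) (simp add: complete)
  also have "\<dots> = e \<bullet>c e"
    by (simp add: cscalar_prod_eq_sum[OF e])
  finally show ?thesis by (metis Re_complex_of_real)
qed

section \<open>The trace as the sum of the eigenvalues with multiplicity\<close>

definition mat_trace :: "complex mat \<Rightarrow> complex" where
  "mat_trace A = (\<Sum>i<dim_row A. A $$ (i, i))"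

lemma mat_trace_mult_comm:
  assumes "A \<in> carrier_mat n m" "B \<in> carrier_mat m n"
  shows "mat_trace (A * B) = mat_trace (B * A)"
proof -
  have "mat_trace (A * B) = (\<Sum>i<n. \<Sum>k<m. A $$ (i, k) * B $$ (k, i))"
    using assms by (auto simp: mat_trace_def scalar_prod_def lessThan_atLeast0 intro!: sum.cong)
  also have "\<dots> = (\<Sum>k<m. \<Sum>i<n. A $$ (i, k) * B $$ (k, i))"
    by (rule sum.swap)
  also have "\<dots> = mat_trace (B * A)"
    using assms by (auto simp: mat_trace_def scalar_prod_def lessThan_atLeast0 mult.commute intro!: sum.cong)
  finally show ?thesis .
qed

text \<open>By Schur decomposition \<open>A\<close> is similar to a triangular matrix
  \<open>B\<close> with the eigenvalues on its diagonal, and cyclicity of the trace makes it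
  invariant under similarity.\<close>

lemma sum_mset_proots_char_poly:
  assumes A: "A \<in> carrier_mat n n"
  shows "\<Sum>\<^sub># (proots (char_poly A)) = mat_trace A"
proof -
  obtain es where es: "char_poly A = (\<Prod>a\<leftarrow>es. [:- a, 1:])" "length es = n"
    using char_poly_factorized[OF A] by blast
  obtain B P Q where BPQ: "schur_decomposition A es = (B, P, Q)"
    by (metis prod_cases3)
  have sim: "similar_mat_wit A B P Q" and diag: "diag_mat B = es"
    using schur_decomposition[OF A es(1) BPQ] by auto
  note D = similar_mat_witD2[OF A sim]
  have "proots (\<Prod>a\<leftarrow>xs. [:- a, 1:]) = mset xs" for xs :: "complex list"
  proof (induction xs)
    case (Cons x xs)
    have "(\<Prod>a\<leftarrow>xs. [:- a, 1:]) \<noteq> 0"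
      by (auto simp: prod_list_zero_iff)
    with Cons show ?case
      by (simp add: proots_mult del: mult_pCons_left)
  qed simp
  then have "\<Sum>\<^sub># (proots (char_poly A)) = sum_list es"
    by (simp add: es(1) sum_mset_sum_list)
  also have "\<dots> = mat_trace B"
    using D(5) by (simp flip: diag add: diag_mat_def mat_trace_def interv_sum_list_conv_sum_set_nat lessThan_atLeast0)
  also have "\<dots> = mat_trace (Q * P * B)"
    using D by simp
  also have "\<dots> = mat_trace (Q * (P * B))"
    using D assoc_mult_mat[of Q n n P n B n] by simp
  also have "\<dots> = mat_trace ((P * B) * Q)"
    using D by (intro mat_trace_mult_comm[of _ n n]) auto
  finally show ?thesis using D by simp
qed

section \<open>Matrix entries of products of rank-1 projections\<close>

text \<open>The common shape of \<open>A\<^sup>* A\<close> for the commutator of two rank-1 projections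
  (\<open>\<alpha> = c\<^sup>2, \<beta> = - c\<^sup>2\<close>) and for their sum (\<open>\<alpha> = \<beta> = 1\<close>), where \<open>c\<close> is the overlap.\<close>

definition two_ket_mat :: "nat \<Rightarrow> real \<Rightarrow> real \<Rightarrow> complex vec \<Rightarrow> complex vec \<Rightarrow> complex mat" where
  "two_ket_mat d \<alpha> \<beta> e f = mat d d (\<lambda>(i, j).
     \<alpha> * (e $ i * cnj (e $ j) + f $ i * cnj (f $ j))
     + \<beta> * ((f \<bullet>c e) * e $ i * cnj (f $ j) + (e \<bullet>c f) * f $ i * cnj (e $ j)))"

lemma two_ket_mat_carrier [simp]: "two_ket_mat d \<alpha> \<beta> e f \<in> carrier_mat d d"
  by (simp add: two_ket_mat_def)

lemma ket_bra_mult: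
  assumes e: "e \<in> carrier_vec d" and f: "f \<in> carrier_vec d"
  shows "ket_bra e * ket_bra f = mat d d (\<lambda>(i, j). (f \<bullet>c e) * e $ i * cnj (f $ j))"
proof (rule eq_matI)
  fix i j assume "i < dim_row (mat d d (\<lambda>(i, j). (f \<bullet>c e) * e $ i * cnj (f $ j)))"
    "j < dim_col (mat d d (\<lambda>(i, j). (f \<bullet>c e) * e $ i * cnj (f $ j)))"
  then have "i < d" "j < d" by auto
  then show "(ket_bra e * ket_bra f) $$ (i, j)
      = mat d d (\<lambda>(i, j). (f \<bullet>c e) * e $ i * cnj (f $ j)) $$ (i, j)"
    using e f by (simp add: ket_bra_def scalar_prod_def lessThan_atLeast0[symmetric]
        cscalar_prod_eq_sum[OF e] sum_distrib_left mult_ac del: sum_constant)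
qed (use e f in \<open>auto simp: ket_bra_def\<close>)

lemma index_mat_adjoint:
  fixes A :: "complex mat"
  assumes "A \<in> carrier_mat n m" "i < m" "j < n"
  shows "mat_adjoint A $$ (i, j) = cnj (A $$ (j, i))"
  using assms by (simp add: mat_adjoint_def mat_of_rows_index)

lemma dim_mat_adjoint [simp]:
  "dim_row (mat_adjoint A) = dim_col A" "dim_col (mat_adjoint A) = dim_row A"
  by (simp_all add: mat_adjoint_def)

lemma index_adjoint_mult_self:
  fixes A :: "complex mat"
  assumes "A \<in> carrier_mat n m" "i < m" "j < m"
  shows "(mat_adjoint A * A) $$ (i, j) = (\<Sum>k<n. cnj (A $$ (k, i)) * A $$ (k, j))"
  using assms by (simp add: scalar_prod_def lessThan_atLeast0 index_mat_adjoint)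

text \<open>A characteristic polynomial is monic, hence nonzero, so its multiset of roots really
  contains all its roots.\<close>

lemma proots_char_poly_two_ket_mat:
  "x \<in># proots (char_poly (two_ket_mat d \<alpha> \<beta> e f))
    \<longleftrightarrow> eigenvalue (two_ket_mat d \<alpha> \<beta> e f) x"
proof -
  have "char_poly (two_ket_mat d \<alpha> \<beta> e f) \<noteq> 0"
    using degree_monic_char_poly[OF two_ket_mat_carrier, of d \<alpha> \<beta> e f] by auto
  then show ?thesis
    by (simp add: eigenvalue_root_char_poly[OF two_ket_mat_carrier])
qed

section \<open>Action, trace and spectrum of \<open>two_ket_mat\<close>\<close>

context
  fixes d :: nat and e f :: "complex vec"
  assumes e: "e \<in> carrier_vec d" and f: "f \<in> carrier_vec d"
begin

lemma overlap_mult: "(f \<bullet>c e) * (e \<bullet>c f) = of_real ((cmod (f \<bullet>c e))\<^sup>2)"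
  by (metis cnj_cscalar_prod[OF e f] complex_norm_square)

text \<open>The image lies in the span of \<open>e\<close> and \<open>f\<close> and depends on
  \<open>v\<close> only through its two inner products with them, so the eigenvalue problem becomes
  two-dimensional.\<close>

lemma two_ket_mat_vec:
  assumes v: "v \<in> carrier_vec d"
  shows "two_ket_mat d \<alpha> \<beta> e f *\<^sub>v v =
    (\<alpha> * (v \<bullet>c e) + \<beta> * (f \<bullet>c e) * (v \<bullet>c f)) \<cdot>\<^sub>v e
    + (\<alpha> * (v \<bullet>c f) + \<beta> * (e \<bullet>c f) * (v \<bullet>c e)) \<cdot>\<^sub>v f" (is "?l = ?r")
proof (rule eq_vecI)
  fix i assume "i < dim_vec ?r"
  then have i: "i < d" using f by simp
  have "?l $ i = (\<Sum>j<d. (\<alpha> * (e $ i * cnj (e $ j) + f $ i * cnj (f $ j))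
     + \<beta> * ((f \<bullet>c e) * e $ i * cnj (f $ j) + (e \<bullet>c f) * f $ i * cnj (e $ j))) * v $ j)"
    using i v by (simp add: two_ket_mat_def scalar_prod_def lessThan_atLeast0)
  also have "\<dots> = (\<Sum>j<d. (\<alpha> * e $ i + \<beta> * (e \<bullet>c f) * f $ i) * (cnj (e $ j) * v $ j)
     + (\<alpha> * f $ i + \<beta> * (f \<bullet>c e) * e $ i) * (cnj (f $ j) * v $ j))"
    by (intro sum.cong) (auto simp: algebra_simps)
  also have "\<dots> = (\<alpha> * e $ i + \<beta> * (e \<bullet>c f) * f $ i) * (v \<bullet>c e)
     + (\<alpha> * f $ i + \<beta> * (f \<bullet>c e) * e $ i) * (v \<bullet>c f)"
    by (simp add: sum.distrib cscalar_prod_eq_sum[OF e, of v] cscalar_prod_eq_sum[OF f, of v] sum_distrib_left)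
  also have "\<dots> = ?r $ i"
    using i e f by (simp add: algebra_simps)
  finally show "?l $ i = ?r $ i" .
qed (use f in \<open>simp add: two_ket_mat_def\<close>)

lemma cscalar_prod_lincomb:
  assumes "g \<in> carrier_vec d"
  shows "(x \<cdot>\<^sub>v e + y \<cdot>\<^sub>v f) \<bullet>c g = x * (e \<bullet>c g) + y * (f \<bullet>c g)"
  using assms e f by (simp add: add_scalar_prod_distrib[of _ d] smult_scalar_prod_distrib[of _ d])

lemma commutator_ket_bra:
  "commutator (ket_bra e) (ket_bra f)
    = mat d d (\<lambda>(i, j). (f \<bullet>c e) * e $ i * cnj (f $ j) - (e \<bullet>c f) * f $ i * cnj (e $ j))"
  unfolding commutator_def ket_bra_mult[OF e f] ket_bra_mult[OF f e]
  by (rule eq_matI) auto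

context
  assumes ee: "e \<bullet>c e = 1" and ff: "f \<bullet>c f = 1"
begin

lemma sum_cnj_mult_kets:
  "(\<Sum>k<d. cnj (e $ k) * e $ k) = 1" "(\<Sum>k<d. cnj (f $ k) * f $ k) = 1"
  "(\<Sum>k<d. cnj (e $ k) * f $ k) = f \<bullet>c e" "(\<Sum>k<d. cnj (f $ k) * e $ k) = e \<bullet>c f"
  by (simp_all only: ee ff cscalar_prod_eq_sum[OF e, symmetric] cscalar_prod_eq_sum[OF f, symmetric])

lemma trace_two_ket_mat:
  "mat_trace (two_ket_mat d \<alpha> \<beta> e f) = of_real (2 * (\<alpha> + \<beta> * (cmod (f \<bullet>c e))\<^sup>2))"
proof -
  have "mat_trace (two_ket_mat d \<alpha> \<beta> e f) =
    (\<Sum>i<d. \<alpha> * (cnj (e $ i) * e $ i) + \<alpha> * (cnj (f $ i) * f $ i)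
      + \<beta> * (f \<bullet>c e) * (cnj (f $ i) * e $ i) + \<beta> * (e \<bullet>c f) * (cnj (e $ i) * f $ i))"
    by (simp add: mat_trace_def two_ket_mat_def algebra_simps)
  also have "\<dots> = \<alpha> + \<alpha> + \<beta> * ((f \<bullet>c e) * (e \<bullet>c f)) + \<beta> * ((f \<bullet>c e) * (e \<bullet>c f))"
    unfolding sum.distrib sum_distrib_left[symmetric] sum_cnj_mult_kets by simp
  finally show ?thesis unfolding overlap_mult by simp
qed

text \<open>Pairing the eigenvalue equation with \<open>e\<close> and with \<open>f\<close> gives a
  2x2 linear system for the inner products \<open>x\<close> and \<open>y\<close>. Its diagonal
  entries both equal \<alpha> + \<beta> \<open>c\<^sup>2\<close>, and its off-diagonal entries have
  product \<open>((\<alpha> + \<beta>) * c)\<^sup>2\<close>. The argument also covers linearly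
  dependent \<open>e\<close> and \<open>f\<close>.\<close>

lemma eigenvalue_two_ket_mat_cases:
  assumes "eigenvalue (two_ket_mat d \<alpha> \<beta> e f) \<kappa>"
  defines "c \<equiv> cmod (f \<bullet>c e)"
  shows "\<kappa> = 0 \<or> \<kappa> = of_real ((1 + c) * (\<alpha> + \<beta> * c)) \<or> \<kappa> = of_real ((1 - c) * (\<alpha> - \<beta> * c))"
proof (cases "\<kappa> = 0")
  case False
  define z where "z = f \<bullet>c e"
  define w where "w = e \<bullet>c f"
  obtain v where v: "v \<in> carrier_vec d" "v \<noteq> 0\<^sub>v d" "two_ket_mat d \<alpha> \<beta> e f *\<^sub>v v = \<kappa> \<cdot>\<^sub>v v"
    using assms by (auto simp: eigenvalue_def eigenvector_def two_ket_mat_def)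
  define x where "x = v \<bullet>c e"
  define y where "y = v \<bullet>c f"
  have eq: "\<kappa> \<cdot>\<^sub>v v = (\<alpha> * x + \<beta> * z * y) \<cdot>\<^sub>v e + (\<alpha> * y + \<beta> * w * x) \<cdot>\<^sub>v f"
    using two_ket_mat_vec[OF v(1), of \<alpha> \<beta>] v(3) by (simp add: x_def y_def z_def w_def)
  have zw: "z * w = of_real (c\<^sup>2)"
    unfolding z_def w_def c_def by (rule overlap_mult)
  have lx: "\<kappa> * x = (\<alpha> * x + \<beta> * z * y) + (\<alpha> * y + \<beta> * w * x) * z"
    using arg_cong[OF eq, of "\<lambda>u. u \<bullet>c e"] v(1) e cscalar_prod_lincomb[OF e] ee
    by (simp add: x_def z_def smult_scalar_prod_distrib[of _ d])
  have ly: "\<kappa> * y = (\<alpha> * x + \<beta> * z * y) * w + (\<alpha> * y + \<beta> * w * x)"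
    using arg_cong[OF eq, of "\<lambda>u. u \<bullet>c f"] v(1) f cscalar_prod_lincomb[OF f] ff
    by (simp add: y_def w_def smult_scalar_prod_distrib[of _ d])
  \<comment> \<open>Subtracting the common diagonal entry leaves a purely off-diagonal system;
    applying it twice determines the square of \<mu>.\<close>
  define \<mu> where "\<mu> = \<kappa> - (\<alpha> + \<beta> * complex_of_real (c\<^sup>2))"
  have mx: "\<mu> * x = (\<alpha> + \<beta>) * z * y"
    using lx unfolding \<mu>_def zw[symmetric] by (simp add: algebra_simps)
  have my: "\<mu> * y = (\<alpha> + \<beta>) * w * x"
    using ly unfolding \<mu>_def zw[symmetric] by (simp add: algebra_simps)
  have "\<mu>\<^sup>2 * x = (\<alpha> + \<beta>) * z * (\<mu> * y)"
    using mx by (simp add: power2_eq_square algebra_simps)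
  also have "\<dots> = (\<alpha> + \<beta>)\<^sup>2 * (z * w) * x"
    unfolding my by (simp add: power2_eq_square algebra_simps)
  finally have mx2: "\<mu>\<^sup>2 * x = ((\<alpha> + \<beta>) * c)\<^sup>2 * x"
    unfolding zw by (simp add: power_mult_distrib)
  have "\<mu>\<^sup>2 * y = (\<alpha> + \<beta>) * w * (\<mu> * x)"
    using my by (simp add: power2_eq_square algebra_simps)
  also have "\<dots> = (\<alpha> + \<beta>)\<^sup>2 * (z * w) * y"
    unfolding mx by (simp add: power2_eq_square algebra_simps)
  finally have my2: "\<mu>\<^sup>2 * y = ((\<alpha> + \<beta>) * c)\<^sup>2 * y"
    unfolding zw by (simp add: power_mult_distrib)
  \<comment> \<open>A vector orthogonal to both kets is mapped to zero, which a nonzero eigenvalue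
    excludes.\<close>
  have "x \<noteq> 0 \<or> y \<noteq> 0"
  proof (rule ccontr)
    assume "\<not> (x \<noteq> 0 \<or> y \<noteq> 0)"
    then have "\<kappa> \<cdot>\<^sub>v v = 0\<^sub>v d"
      using eq e f by (auto intro!: eq_vecI)
    then have "v = 0\<^sub>v d"
      using \<open>\<kappa> \<noteq> 0\<close> v(1)
      by (metis carrier_vecD eq_vecI index_smult_vec(1) index_zero_vec mult_eq_0_iff)
    with v(2) show False by simp
  qed
  then have "\<mu>\<^sup>2 = (of_real ((\<alpha> + \<beta>) * c))\<^sup>2"
    using mx2 my2 by auto
  then have "\<mu> = of_real ((\<alpha> + \<beta>) * c) \<or> \<mu> = - of_real ((\<alpha> + \<beta>) * c)"
    by (simp only: power2_eq_iff)
  then show ?thesis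
    unfolding \<mu>_def by (auto simp: algebra_simps power2_eq_square)
qed simp

text \<open>The eigenvector is \<open>e + w f\<close>, with the phase \<open>w\<close> chosen to
  make the overlap of \<open>w f\<close> with \<open>e\<close> real and nonnegative. Its inner
  product with \<open>e\<close> is \<open>1 + c\<close>, so it never vanishes, whereas
  \<open>e - w f\<close> does for parallel kets.\<close>

lemma eigenvalue_two_ket_mat_plus:
  defines "c \<equiv> cmod (f \<bullet>c e)"
  shows "eigenvalue (two_ket_mat d \<alpha> \<beta> e f) (of_real ((1 + c) * (\<alpha> + \<beta> * c)))"
proof -
  define z where "z = f \<bullet>c e"
  have cnjz: "e \<bullet>c f = cnj z"
    by (simp add: z_def cnj_cscalar_prod[OF e f])
  \<comment> \<open>For \<open>z = 0\<close> any phase works, but \<open>sgn 0 = 0\<close> has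
    modulus zero, so the value 1 is set by hand.\<close>
  define w where "w = (if z = 0 then 1 else cnj (sgn z))"
  have wz: "w * z = c"
    unfolding w_def c_def z_def[symmetric] sgn_eq
    by (simp add: mult.commute) (simp add: complex_norm_square[symmetric] power2_eq_square)
  have "w * cnj w = 1"
    unfolding w_def using complex_norm_square[of "sgn z"] by (cases "z = 0") (simp_all add: norm_sgn mult.commute)
  have cz: "cnj z = w * c"
  proof -
    have "cnj (w * z) = c" unfolding wz by simp
    then have "w * c = w * cnj w * cnj z" by simp
    with \<open>w * cnj w = 1\<close> show ?thesis by simp
  qed
  define v where "v = 1 \<cdot>\<^sub>v e + w \<cdot>\<^sub>v f"
  have v: "v \<in> carrier_vec d" using e f by (simp add: v_def)
  have x: "v \<bullet>c e = 1 + c"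
    using wz unfolding v_def cscalar_prod_lincomb[OF e] by (simp add: ee z_def)
  have y: "v \<bullet>c f = w * (1 + c)"
    using cz unfolding v_def cscalar_prod_lincomb[OF f] by (simp add: ff cnjz algebra_simps)
  have "c \<ge> 0" by (simp add: c_def)
  then have "complex_of_real (1 + c) \<noteq> 0"
    by (subst of_real_eq_0_iff) simp
  then have "v \<noteq> 0\<^sub>v d"
    using x e by auto
  moreover have "two_ket_mat d \<alpha> \<beta> e f *\<^sub>v v = of_real ((1 + c) * (\<alpha> + \<beta> * c)) \<cdot>\<^sub>v v"
  proof -
    have "\<alpha> * (1 + c) + \<beta> * z * (w * (1 + c)) = \<alpha> * (1 + c) + \<beta> * (w * z) * (1 + c)"
      by simp
    also have "\<dots> = of_real ((1 + c) * (\<alpha> + \<beta> * c))"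
      unfolding wz by (simp add: algebra_simps)
    finally have "\<alpha> * (1 + c) + \<beta> * z * (w * (1 + c)) = of_real ((1 + c) * (\<alpha> + \<beta> * c))" .
    moreover have "\<alpha> * (w * (1 + c)) + \<beta> * (w * c) * (1 + c) = of_real ((1 + c) * (\<alpha> + \<beta> * c)) * w"
      by (simp add: algebra_simps)
    ultimately show ?thesis
      unfolding two_ket_mat_vec[OF v] x y cnjz cz z_def[symmetric]
      using e f by (simp add: v_def smult_add_distrib_vec[of _ d] smult_smult_assoc)
  qed
  ultimately show ?thesis
    unfolding eigenvalue_def eigenvector_def using v by (auto simp: two_ket_mat_def)
qed

section \<open>Adjoint products and Schatten norms of the commutator and the sum\<close>

lemma adjoint_commutator_mult_self:
  defines "c \<equiv> cmod (f \<bullet>c e)"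
  shows "mat_adjoint (commutator (ket_bra e) (ket_bra f)) * commutator (ket_bra e) (ket_bra f)
    = two_ket_mat d (c\<^sup>2) (- c\<^sup>2) e f" (is "mat_adjoint ?A * ?A = ?K")
proof (rule eq_matI)
  define z where "z = f \<bullet>c e"
  define w where "w = e \<bullet>c f"
  have cnj: "cnj z = w" "cnj w = z"
    by (simp_all add: z_def w_def cnj_cscalar_prod[OF e f] cnj_cscalar_prod[OF f e])
  have zw: "z * w = (complex_of_real c)\<^sup>2"
    unfolding z_def w_def c_def using overlap_mult by simp
  have A: "?A \<in> carrier_mat d d"
    by (simp add: commutator_ket_bra)
  fix i j assume "i < dim_row ?K" "j < dim_col ?K"
  then have ij: "i < d" "j < d" by (auto simp: two_ket_mat_def)
  have "(mat_adjoint ?A * ?A) $$ (i, j) = (\<Sum>k<d.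
      (w * cnj (e $ k) * f $ i - z * cnj (f $ k) * e $ i)
      * (z * e $ k * cnj (f $ j) - w * f $ k * cnj (e $ j)))"
    unfolding index_adjoint_mult_self[OF A ij] using ij
    by (simp add: commutator_ket_bra cnj flip: z_def w_def)
  \<comment> \<open>After summation over \<open>k\<close> the last two sums become \<open>z\<close>
    and \<open>w\<close>. Together with the squares \<open>w\<^sup>2\<close> and
    \<open>z\<^sup>2\<close> in front they also yield a factor \<open>z * w\<close>, so all four
    terms carry \<open>c\<^sup>2\<close>.\<close>
  also have "\<dots> = (\<Sum>k<d. (z * w * f $ i * cnj (f $ j)) * (cnj (e $ k) * e $ k)
      + (z * w * e $ i * cnj (e $ j)) * (cnj (f $ k) * f $ k)
      - (w\<^sup>2 * f $ i * cnj (e $ j)) * (cnj (e $ k) * f $ k)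
      - (z\<^sup>2 * e $ i * cnj (f $ j)) * (cnj (f $ k) * e $ k))"
    by (intro sum.cong) (auto simp: algebra_simps power2_eq_square)
  also have "\<dots> = z * w * f $ i * cnj (f $ j) + z * w * e $ i * cnj (e $ j)
      - z * w * (w * f $ i * cnj (e $ j)) - z * w * (z * e $ i * cnj (f $ j))"
    unfolding sum.distrib sum_subtractf sum_distrib_left[symmetric] sum_cnj_mult_kets
    by (simp add: power2_eq_square flip: z_def w_def)
  also have "\<dots> = ?K $$ (i, j)"
    using ij unfolding zw by (simp add: two_ket_mat_def algebra_simps flip: z_def w_def)
  finally show "(mat_adjoint ?A * ?A) $$ (i, j) = ?K $$ (i, j)" .
qed (simp_all add: commutator_ket_bra two_ket_mat_def)

lemma adjoint_add_mult_self:
  "mat_adjoint (ket_bra e + ket_bra f) * (ket_bra e + ket_bra f) = two_ket_mat d 1 1 e f"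
  (is "mat_adjoint ?A * ?A = ?K")
proof (rule eq_matI)
  have A: "?A \<in> carrier_mat d d"
    using e f by (simp add: ket_bra_def)
  fix i j assume "i < dim_row ?K" "j < dim_col ?K"
  then have ij: "i < d" "j < d" by (auto simp: two_ket_mat_def)
  have "(mat_adjoint ?A * ?A) $$ (i, j) = (\<Sum>k<d.
      (cnj (e $ k) * e $ i + cnj (f $ k) * f $ i)
      * (e $ k * cnj (e $ j) + f $ k * cnj (f $ j)))"
    unfolding index_adjoint_mult_self[OF A ij] using ij e f
    by (simp add: ket_bra_def)
  also have "\<dots> = (\<Sum>k<d. (e $ i * cnj (e $ j)) * (cnj (e $ k) * e $ k)
      + (f $ i * cnj (f $ j)) * (cnj (f $ k) * f $ k)
      + (e $ i * cnj (f $ j)) * (cnj (e $ k) * f $ k)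
      + (f $ i * cnj (e $ j)) * (cnj (f $ k) * e $ k))"
    by (intro sum.cong) (auto simp: algebra_simps)
  also have "\<dots> = ?K $$ (i, j)"
    unfolding sum.distrib sum_distrib_left[symmetric] sum_cnj_mult_kets
    using ij by (simp add: two_ket_mat_def algebra_simps)
  finally show "(mat_adjoint ?A * ?A) $$ (i, j) = ?K $$ (i, j)" .
qed (use e f in \<open>simp_all add: ket_bra_def two_ket_mat_def\<close>)

text \<open>The value \<open>(1 + c)\<^sup>2\<close> is always an eigenvalue of the adjoint product,
  and since \<open>c\<close> is nonnegative it dominates the other candidates 0 and
  \<open>(1 - c)\<^sup>2\<close>.\<close>

lemma schatten_norm_add_ket_bra:
  "schatten_norm \<infinity> (ket_bra e + ket_bra f) = 1 + cmod (f \<bullet>c e)"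
proof -
  define c where "c = cmod (f \<bullet>c e)"
  have "c \<ge> 0" by (simp add: c_def)
  have sv: "set_mset (singular_values (ket_bra e + ket_bra f))
      = (\<lambda>x. sqrt (Re x)) ` {x. eigenvalue (two_ket_mat d 1 1 e f) x}"
    unfolding singular_values_def adjoint_add_mult_self set_image_mset
    using proots_char_poly_two_ket_mat by auto
  have "Max (set_mset (singular_values (ket_bra e + ket_bra f))) = 1 + c"
  proof (rule Max_eqI)
    fix s assume "s \<in> set_mset (singular_values (ket_bra e + ket_bra f))"
    then obtain x where x: "eigenvalue (two_ket_mat d 1 1 e f) x" "s = sqrt (Re x)"
      unfolding sv by auto
    have "Re x = 0 \<or> Re x = (1 + c) * (1 + 1 * c) \<or> Re x = (1 - c) * (1 - 1 * c)"
      using eigenvalue_two_ket_mat_cases[OF x(1)]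
      unfolding c_def[symmetric] by (metis Re_complex_of_real zero_complex.sel(1))
    then have "Re x \<le> (1 + c)\<^sup>2"
      using \<open>c \<ge> 0\<close> by (auto simp: power2_eq_square algebra_simps)
    then show "s \<le> 1 + c"
      using \<open>c \<ge> 0\<close> x(2) real_le_lsqrt[of "1 + c" "Re x"] by simp
  next
    have "sqrt ((1 + c) * (1 + c)) \<in> set_mset (singular_values (ket_bra e + ket_bra f))"
      unfolding sv using eigenvalue_two_ket_mat_plus[of 1 1]
      by (auto simp: c_def intro!: image_eqI)
    then show "1 + c \<in> set_mset (singular_values (ket_bra e + ket_bra f))"
      using \<open>c \<ge> 0\<close> by simp
  qed simp
  then show ?thesis by (simp add: schatten_norm_def c_def)
qed

lemma schatten_norm_commutator_ket_bra:
  assumes "1 \<le> p" "cmod (f \<bullet>c e) \<le> 1"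
  shows "schatten_norm p (commutator (ket_bra e) (ket_bra f)) = h p (cmod (f \<bullet>c e))"
  \<comment> \<open>The only nonzero eigenvalue of \<open>A\<^sup>*A\<close> is \<open>\<kappa> = c\<^sup>2 (1 - c\<^sup>2)\<close>, and the trace \<open>2 \<kappa>\<close> forces multiplicity 2.\<close>
proof -
  define c where "c = cmod (f \<bullet>c e)"
  define s where "s = c * sqrt (1 - c\<^sup>2)"
  define \<kappa> where "\<kappa> = s\<^sup>2"
  define X where "X = proots (char_poly (two_ket_mat d (c\<^sup>2) (- c\<^sup>2) e f))"
  have c: "0 \<le> c" "c \<le> 1" using assms by (auto simp: c_def)
  then have c2: "c\<^sup>2 \<le> 1" by (simp add: power_le_one)
  with c have "s \<ge> 0" by (simp add: s_def)
  have \<kappa>: "\<kappa> = c\<^sup>2 * (1 - c\<^sup>2)"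
    using c2 by (simp add: \<kappa>_def s_def power_mult_distrib)
  have sv: "singular_values (commutator (ket_bra e) (ket_bra f)) = image_mset (\<lambda>x. sqrt (Re x)) X"
    by (simp add: singular_values_def adjoint_commutator_mult_self X_def c_def)
  have X: "x = 0 \<or> x = of_real \<kappa>" if "x \<in># X" for x
  proof -
    \<comment> \<open>Since \<alpha> + \<beta> = 0 here, the two nonzero candidates for an
      eigenvalue coincide.\<close>
    have "(1 + c) * (c\<^sup>2 + - c\<^sup>2 * c) = \<kappa>" "(1 - c) * (c\<^sup>2 - - c\<^sup>2 * c) = \<kappa>"
      by (simp_all add: \<kappa> power2_eq_square algebra_simps)
    moreover have "eigenvalue (two_ket_mat d (c\<^sup>2) (- c\<^sup>2) e f) x"
      using that unfolding X_def proots_char_poly_two_ket_mat .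
    ultimately show ?thesis
      using eigenvalue_two_ket_mat_cases[of "c\<^sup>2" "- c\<^sup>2" x]
      unfolding c_def[symmetric] by metis
  qed
  have "eigenvalue (two_ket_mat d (c\<^sup>2) (- c\<^sup>2) e f) (of_real ((1 + c) * (c\<^sup>2 + - c\<^sup>2 * c)))"
    unfolding c_def by (rule eigenvalue_two_ket_mat_plus)
  also have "(1 + c) * (c\<^sup>2 + - c\<^sup>2 * c) = \<kappa>"
    by (simp add: \<kappa> power2_eq_square algebra_simps)
  finally have \<kappa>X: "of_real \<kappa> \<in># X"
    unfolding X_def proots_char_poly_two_ket_mat .
  have sqrt_\<kappa>: "sqrt \<kappa> = s"
    using \<open>s \<ge> 0\<close> by (simp add: \<kappa>_def)
  have "schatten_norm p (commutator (ket_bra e) (ket_bra f)) = two_root p * s"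
  proof (cases "p = \<infinity>")
    case True
    have "Max ((\<lambda>x. sqrt (Re x)) ` set_mset X) = s"
    proof (rule Max_eqI)
      show "y \<le> s" if "y \<in> (\<lambda>x. sqrt (Re x)) ` set_mset X" for y
        using that X \<open>s \<ge> 0\<close> sqrt_\<kappa> by fastforce
      show "s \<in> (\<lambda>x. sqrt (Re x)) ` set_mset X"
        using \<kappa>X sqrt_\<kappa> by (intro image_eqI[of _ _ "of_real \<kappa>"]) auto
    qed simp
    then show ?thesis
      by (simp add: True schatten_norm_def sv two_root_def)
  next
    case False
    then obtain r where r: "p = ereal r" "r \<ge> 1"
      using assms(1) by (cases p) auto
    \<comment> \<open>The codomain is left general: the complex identity function extracts the
      multiplicity of \<kappa> from the trace, and real powers then give the norm.\<close>
    have sum_X: "\<Sum>\<^sub># (image_mset g Y) = of_nat (count Y k) * g k"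
      if "\<forall>x\<in>#Y. x = 0 \<or> x = k" "k \<noteq> 0" "g 0 = 0"
      for g :: "complex \<Rightarrow> 'b::comm_semiring_1" and Y k
      using that by (induction Y) (auto simp: algebra_simps)
    have "(\<Sum>y\<in>#singular_values (commutator (ket_bra e) (ket_bra f)). y powr r) = 2 * s powr r"
    \<comment> \<open>For \<kappa> = 0 the trace says nothing about multiplicities, but then all
      singular values are 0 and \<open>0 powr r = 0\<close>.\<close>
    proof (cases "\<kappa> = 0")
      case True
      then have "s = 0" by (simp add: \<kappa>_def)
      have "x = 0" if "x \<in># X" for x
        using X[OF that] True by simp
      then have "(\<Sum>x\<in>#X. sqrt (Re x) powr r) = (\<Sum>x\<in>#X. 0)"
        by (intro arg_cong[of _ _ sum_mset] image_mset_cong) fastforce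
      then show ?thesis
        by (simp add: sv \<open>s = 0\<close> multiset.map_comp comp_def)
    next
      case False
      have "of_nat (count X \<kappa>) * complex_of_real \<kappa> = \<Sum>\<^sub># X"
        using sum_X[of X \<kappa> "\<lambda>x. x"] X False by simp
      also have "\<dots> = of_real (2 * \<kappa>)"
        unfolding X_def sum_mset_proots_char_poly[OF two_ket_mat_carrier]
          trace_two_ket_mat
        by (simp add: \<kappa> algebra_simps flip: c_def)
      finally have "of_nat (count X \<kappa>) = (2 :: complex)"
        using False by simp
      then have "count X \<kappa> = 2"
        by (metis of_nat_eq_iff of_nat_numeral)
      then show ?thesis
        using sum_X[of X \<kappa> "\<lambda>x. sqrt (Re x) powr r"] X False
        by (simp add: sv multiset.map_comp comp_def sqrt_\<kappa>)
    qed
    then show ?thesis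
      using \<open>s \<ge> 0\<close> r by (simp add: schatten_norm_def two_root_def powr_mult powr_powr)
  qed
  then show ?thesis
    by (simp add: h_def s_def c_def)
qed

end

end

section \<open>Chord bounds for \<open>h\<close> and their average\<close>

lemma two_root_pos: "two_root p > 0"
  by (simp add: two_root_def)

lemma h_nonneg: "0 \<le> c \<Longrightarrow> c \<le> 1 \<Longrightarrow> h p c \<ge> 0"
  using two_root_pos[of p] by (simp add: h_def power_le_one)

text \<open>The bound is the chord through the origin, of slope \<open>h p m / m\<close>; it lies
  below \<open>h p\<close> because \<open>sqrt (1 - x\<^sup>2)\<close> decreases on [0,1].\<close>

lemma h_ge_below:
  assumes "0 \<le> c" "c \<le> m" "0 < m" "m < 1"
  shows "h p c \<ge> h p m - h p m / m * (m - c)"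
proof -
  have "h p m - h p m / m * (m - c) = h p m / m * c"
    using assms by (simp add: field_simps)
  also have "\<dots> = two_root p * c * sqrt (1 - m\<^sup>2)"
    using assms by (simp add: h_def)
  also have "\<dots> \<le> h p c"
    using assms two_root_pos[of p] unfolding h_def
    by (intro mult_left_mono) (auto intro: power_mono)
  finally show ?thesis .
qed

text \<open>The bound is the chord from \<open>m\<close> to the zero of \<open>h p\<close> at 1.
  Factoring \<open>sqrt (1 - x\<^sup>2)\<close> as below, \<open>x * sqrt (1 + x)\<close> increases
  and \<open>sqrt (1 - x)\<close> lies above its own chord.\<close>

lemma h_ge_above:
  assumes "m \<le> c" "c \<le> 1" "0 < m" "m < 1"
  shows "h p c \<ge> h p m - h p m / (1 - m) * (c - m)"
proof -
  have split: "sqrt (1 - x\<^sup>2) = sqrt (1 - x) * sqrt (1 + x)" for x :: real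
    by (simp add: power2_eq_square algebra_simps flip: real_sqrt_mult)
  have "sqrt (1 - m) * (1 - c) = sqrt (1 - m) * sqrt (1 - c) * sqrt (1 - c)"
    using assms by simp
  also have "\<dots> \<le> sqrt (1 - m) * sqrt (1 - c) * sqrt (1 - m)"
    using assms by (intro mult_left_mono) auto
  also have "\<dots> = sqrt (1 - c) * (1 - m)"
    using assms by simp
  \<comment> \<open>The chord bound for \<open>sqrt (1 - x)\<close>: it rests only on
    \<open>sqrt (1 - c)\<close> being at most \<open>sqrt (1 - m)\<close>.\<close>
  finally have *: "sqrt (1 - m) * (1 - c) / (1 - m) \<le> sqrt (1 - c)"
    using assms by (simp add: field_simps)
  have "h p m - h p m / (1 - m) * (c - m) = h p m * (1 - c) / (1 - m)"
    using assms by (simp add: field_simps)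
  also have "\<dots> = two_root p * m * sqrt (1 + m) * (sqrt (1 - m) * (1 - c) / (1 - m))"
    by (simp add: h_def split)
  also have "\<dots> \<le> two_root p * c * sqrt (1 + c) * sqrt (1 - c)"
    using assms two_root_pos[of p] * by (intro mult_mono) auto
  also have "\<dots> = h p c"
    by (simp add: h_def split)
  finally show ?thesis .
qed

text \<open>Both chord slopes are at most \<open>alpha p m\<close>, so one linear bound serves on
  either side of \<open>m\<close>.\<close>

lemma h_ge_alpha:
  assumes "0 \<le> c" "c \<le> 1" "0 < m" "m < 1"
  shows "h p c \<ge> h p m - alpha p m * \<bar>c - m\<bar>"
proof -
  have "h p m / m \<le> alpha p m" "h p m / (1 - m) \<le> alpha p m"
    by (auto simp: alpha_def)
  then have "h p m / m * \<bar>c - m\<bar> \<le> alpha p m * \<bar>c - m\<bar>"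
     "h p m / (1 - m) * \<bar>c - m\<bar> \<le> alpha p m * \<bar>c - m\<bar>"
    by (simp_all only: mult_right_mono abs_ge_zero)
  then show ?thesis
    using h_ge_below[of c m p] h_ge_above[of m c p] assms by (cases "c \<le> m") (auto simp: abs_if)
qed

text \<open>As \<open>m\<close> is the mean of the \<open>c i\<close>, their squared deviations add
  up to the expression under the second root; Cauchy-Schwarz passes from these to the absolute
  deviations in the pointwise bound.\<close>

lemma sum_h_ge:
  fixes c :: "'i \<Rightarrow> real"
  assumes "\<And>i. i \<in> I \<Longrightarrow> 0 \<le> c i \<and> c i \<le> 1"
    and m: "0 < m" "m < 1" "sum c I = real (card I) * m"
  shows "(\<Sum>i\<in>I. h p (c i)) \<ge> real (card I) * h p m
    - alpha p m * sqrt (real (card I)) * sqrt ((\<Sum>i\<in>I. (c i)\<^sup>2) - real (card I) * m\<^sup>2)"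
proof -
  have "(\<Sum>i\<in>I. (c i - m)\<^sup>2) = (\<Sum>i\<in>I. (c i)\<^sup>2) - 2 * m * sum c I + real (card I) * m\<^sup>2"
    unfolding sum_distrib_left
    by (simp add: power2_diff sum.distrib sum_subtractf mult_ac)
  also have "\<dots> = (\<Sum>i\<in>I. (c i)\<^sup>2) - real (card I) * m\<^sup>2"
    by (simp add: m power2_eq_square)
  finally have var: "(\<Sum>i\<in>I. \<bar>c i - m\<bar>\<^sup>2) = (\<Sum>i\<in>I. (c i)\<^sup>2) - real (card I) * m\<^sup>2"
    by simp
  have "(\<Sum>i\<in>I. \<bar>c i - m\<bar>)\<^sup>2 \<le> (\<Sum>i\<in>I. \<bar>c i - m\<bar>\<^sup>2) * card I"
    by (rule sum_squared_le_sum_of_squares)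
  then have "(\<Sum>i\<in>I. \<bar>c i - m\<bar>)
      \<le> sqrt (real (card I)) * sqrt ((\<Sum>i\<in>I. (c i)\<^sup>2) - real (card I) * m\<^sup>2)"
    unfolding var by (metis real_le_rsqrt real_sqrt_mult mult.commute)
  moreover have "alpha p m \<ge> 0"
    using m h_nonneg[of m p] by (auto simp: alpha_def Max_ge_iff)
  ultimately have "alpha p m * (\<Sum>i\<in>I. \<bar>c i - m\<bar>)
      \<le> alpha p m * (sqrt (real (card I)) * sqrt ((\<Sum>i\<in>I. (c i)\<^sup>2) - real (card I) * m\<^sup>2))"
    by (rule mult_left_mono)
  moreover have "(\<Sum>i\<in>I. h p m - alpha p m * \<bar>c i - m\<bar>) \<le> (\<Sum>i\<in>I. h p (c i))"
    using assms by (intro sum_mono h_ge_alpha) auto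
  ultimately show ?thesis
    by (simp add: sum_subtractf sum_distrib_left mult.assoc)
qed

section \<open>Summation over all pairs of basis vectors\<close>

theorem mainTheorem6:
  fixes d :: nat and p :: ereal and E F :: "nat \<Rightarrow> complex mat"
  assumes "d \<ge> 2" and "1 \<le> p"
    and "rank1_projective_measurement d E"
    and "rank1_projective_measurement d F"
  shows "Upsilon d p E F \<ge>
           (real d)\<^sup>2 * h p (c_bar d E F)
             - alpha p (c_bar d E F) * real d * sqrt (real d - (real d)\<^sup>2 * (c_bar d E F)\<^sup>2)
       \<and> (p_ave d E F = 1 / 2 + 1 / (2 * sqrt (real d)) \<longrightarrow>
           Upsilon d p E F \<ge> two_root p * real d * sqrt (real d - 1))"
proof -
  obtain e f where e: "orthonormal_basis d e" and f: "orthonormal_basis d f"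
    and E: "\<And>a. a \<in> {1..d} \<Longrightarrow> E a = ket_bra (e a)"
    and F: "\<And>b. b \<in> {1..d} \<Longrightarrow> F b = ket_bra (f b)"
    using assms(3,4) unfolding rank1_projective_measurement_def by metis
  have ec: "e a \<in> carrier_vec d" "e a \<bullet>c e a = 1"
    and fc: "f a \<in> carrier_vec d" "f a \<bullet>c f a = 1" if "a \<in> {1..d}" for a
    using e f that orthonormal_basis_carrier by (auto simp: orthonormal_basis_def)
  define c where "c = (\<lambda>(a, b). cmod (f b \<bullet>c e a))"
  define m where "m = c_bar d E F"
  define I where "I = {1..d} \<times> {1..d}"
  have card: "real (card I) = (real d)\<^sup>2"
    by (simp add: I_def power2_eq_square)
  have d: "real d \<ge> 2" using assms(1) by simp
  have parseval_c: "(\<Sum>b=1..d. (c (a, b))\<^sup>2) = 1" if "a \<in> {1..d}" for a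
    using parseval[OF f ec(1)[OF that]] ec(2)[OF that] by (simp add: c_def)
  have "(\<Sum>i\<in>I. (c i)\<^sup>2) = (\<Sum>a=1..d. 1)"
    unfolding I_def sum.cartesian_product' by (intro sum.cong refl parseval_c)
  then have sum_sq: "(\<Sum>i\<in>I. (c i)\<^sup>2) = real d"
    by simp
  have c01: "0 \<le> c i \<and> c i \<le> 1" if iI: "i \<in> I" for i
  proof -
    obtain a b where i: "i = (a, b)" "a \<in> {1..d}" "b \<in> {1..d}"
      using iI unfolding I_def by blast
    have "(c (a, b))\<^sup>2 \<le> (\<Sum>b=1..d. (c (a, b))\<^sup>2)"
      using i by (intro member_le_sum) auto
    then have "(c i)\<^sup>2 \<le> 1"
      unfolding parseval_c[OF i(2)] i(1) .
    then show ?thesis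
      by (auto simp: c_def abs_square_le_1 i)
  qed
  have "Upsilon d p E F = (\<Sum>a=1..d. \<Sum>b=1..d. h p (c (a, b)))"
    unfolding Upsilon_def
  proof (intro sum.cong refl)
    fix a b assume ab: "a \<in> {1..d}" "b \<in> {1..d}"
    then have "c (a, b) \<le> 1" using c01 by (auto simp: I_def)
    then show "schatten_norm p (commutator (E a) (F b)) = h p (c (a, b))"
      using ab ec fc schatten_norm_commutator_ket_bra[of "e a" d "f b" p] assms(2)
      by (simp add: E F c_def)
  qed
  then have Upsilon: "Upsilon d p E F = (\<Sum>i\<in>I. h p (c i))"
    by (simp add: I_def sum.cartesian_product')
  have norm_add: "schatten_norm \<infinity> (E a + F b) = 1 + c (a, b)" if "a \<in> {1..d}" "b \<in> {1..d}" for a b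
    using that ec fc schatten_norm_add_ket_bra[of "e a" d "f b"] by (simp add: E F c_def)
  have "(\<Sum>a=1..d. \<Sum>b=1..d. schatten_norm \<infinity> (E a + F b)) = (\<Sum>a=1..d. \<Sum>b=1..d. 1 + c (a, b))"
    by (intro sum.cong refl norm_add)
  also have "(\<Sum>a=1..d. \<Sum>b=1..d. 1 + c (a, b)) = (real d)\<^sup>2 + sum c I"
    by (simp add: sum.distrib I_def sum.cartesian_product' power2_eq_square)
  finally have "p_ave d E F = 1 / (2 * (real d)\<^sup>2) * ((real d)\<^sup>2 + sum c I)"
    unfolding p_ave_def by (rule arg_cong)
  then have sum_c: "sum c I = real (card I) * m"
    using d by (simp add: card m_def c_bar_def field_simps)
  \<comment> \<open>On [0,1] a square is at most its base, so the sum of squares \<open>d\<close>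
    bounds the sum of overlaps from below and keeps the mean positive.\<close>
  have "real d \<le> sum c I"
    unfolding sum_sq[symmetric] using c01
    by (intro sum_mono) (auto simp: power2_eq_square mult_left_le)
  then have "m > 0"
    using d unfolding sum_c card by (smt (verit) mult_nonneg_nonpos zero_le_power2)
  \<comment> \<open>Cauchy-Schwarz on the overlaps gives \<open>d * m\<^sup>2 \<le> 1\<close> after
    cancelling the cube of \<open>d\<close>; with \<open>d \<ge> 2\<close> this makes
    \<open>m\<close> strictly less than 1.\<close>
  have "((real d)\<^sup>2 * m)\<^sup>2 \<le> real d * (real d)\<^sup>2"
    using sum_squared_le_sum_of_squares[of c I] unfolding sum_c sum_sq card .
  then have "(real d) ^ 3 * (real d * m\<^sup>2) \<le> real d ^ 3 * 1"
    by (simp add: power2_eq_square power3_eq_cube mult_ac)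
  then have "real d * m\<^sup>2 \<le> 1"
    using d by (subst (asm) mult_le_cancel_left_pos) auto
  then have "real d * m\<^sup>2 < real d * 1"
    using d by linarith
  then have "m\<^sup>2 < 1"
    by (rule mult_left_less_imp_less) simp
  then have "m < 1"
    using \<open>m > 0\<close> by (simp add: abs_square_less_1)
  from sum_h_ge[of I c m p, OF c01 \<open>m > 0\<close> \<open>m < 1\<close> sum_c]
  have main: "Upsilon d p E F \<ge> (real d)\<^sup>2 * h p m
      - alpha p m * real d * sqrt (real d - (real d)\<^sup>2 * m\<^sup>2)"
    unfolding Upsilon card sum_sq by simp
  moreover have "Upsilon d p E F \<ge> two_root p * real d * sqrt (real d - 1)"
    if "p_ave d E F = 1 / 2 + 1 / (2 * sqrt (real d))"
  proof -
    have m: "m = 1 / sqrt (real d)"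
      using that by (simp add: m_def c_bar_def)
    have m2: "m\<^sup>2 = 1 / real d"
      using d by (simp add: m power_divide)
    have "(real d)\<^sup>2 * m * sqrt (1 - m\<^sup>2) = real d * (real d / sqrt (real d)) * sqrt ((real d - 1) / real d)"
      using d by (simp add: m2 m diff_divide_distrib power2_eq_square)
    also have "\<dots> = real d * sqrt (real d) * (sqrt (real d - 1) / sqrt (real d))"
      using d by (simp add: real_div_sqrt real_sqrt_divide)
    also have "\<dots> = real d * sqrt (real d - 1)"
      using d by simp
    finally have "(real d)\<^sup>2 * h p m = two_root p * real d * sqrt (real d - 1)"
      by (simp add: h_def mult_ac)
    \<comment> \<open>The variance of the overlaps vanishes, as for mutually unbiased bases, so the
      correction term disappears and only the main term remains.\<close>
    moreover have "real d - (real d)\<^sup>2 * m\<^sup>2 = 0"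
      unfolding m2 using d by (simp add: power2_eq_square)
    ultimately show ?thesis
      using main by simp
  qed
  ultimately show ?thesis
    unfolding m_def by blast
qed

end
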